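(* Let $D\subset\mathbb{C}$ be an open set. For all integers $\lambda_1,\lambda_2\ge 1$ and $\ell\in\mathbb{N}$, one has the equality of linear maps $\mathcal{O}(D\times D)\to\mathcal{O}(D)$ $$T_{\lambda_1,\lambda_2}^{(\ell)}=\frac{(-1)^{\lambda_1+\ell-1}(\lambda_1+\lambda_2+\ell-2)!}{(\lambda_1+\ell-1)!\,(\lambda_2+\ell-1)!}\,\mathrm{RC}_{\lambda_1,\lambda_2}^{(\ell)}.$$
   Context: $\mathbb{N}=\{0,1,2,\dots\}$; $\mathcal{O}(\cdot)$ denotes the space of holomorphic functions. Rankin--Cohen bracket: for integers $\lambda_1,\lambda_2\ge1$ and $\ell\in\mathbb{N}$, $\mathrm{RC}_{\lambda_1,\lambda_2}^{(\ell)}:\mathcal{O}(D\times D)\to\mathcal{O}(D)$ is the bi-differential operator $$(\mathrm{RC}_{\lambda_1,\lambda_2}^{(\ell)}f)(z)=\sum_{j=0}^{\ell}(-1)^j\binom{\lambda_1+\ell-1}{j}\binom{\lambda_2+\ell-1}{\ell-j}\left(\frac{\partial^{\ell}f}{\partial\zeta_1^{\ell-j}\,\partial\zeta_2^{j}}\right)(z,z).$$ Integral operator: for $\zeta_1\neq z\neq\zeta_2$ put $$A_{\lambda_1,\lambda_2}^{(\ell)}(\zeta_1,\zeta_2;z)=\frac{(\zeta_1-\zeta_2)^{\lambda_1+\lambda_2+\ell-2}}{(\zeta_1-z)^{\lambda_2+\ell}(\zeta_2-z)^{\lambda_1+\ell}},$$ and for $f\in\mathcal{O}(D\times D)$, $z\in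 D$, define $$(T_{\lambda_1,\lambda_2}^{(\ell)}f)(z)=\frac{1}{(2\pi\sqrt{-1})^2}\oint_{C_1}\oint_{C_2}A_{\lambda_1,\lambda_2}^{(\ell)}(\zeta_1,\zeta_2;z)f(\zeta_1,\zeta_2)\,d\zeta_1\,d\zeta_2,$$ where $\zeta_j$ runs over $C_j$, and $C_1,C_2$ are positively oriented contours in $D$ around the point $z$ (for instance small circles centered at $z$ bounding closed discs contained in $D$); the value does not depend on the choice of contours. *)

theory Defs
  imports "HOL-Complex_Analysis.Complex_Analysis"
begin

text \<open>Holomorphy in two variables: complex Frechet differentiability at every point, i.e. the real
  derivative exists and is complex linear.\<close>

definition holomorphic2_on :: "(complex \<times> complex \<Rightarrow> complex) \<Rightarrow> (complex \<times> complex) set \<Rightarrow> bool"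
    (infixl "holomorphic2'_on" 50) where
  "f holomorphic2_on U \<longleftrightarrow>
     (\<forall>p\<in>U. \<exists>a b. (f has_derivative (\<lambda>h. a * fst h + b * snd h)) (at p within U))"

definition mixed_deriv :: "nat \<Rightarrow> nat \<Rightarrow> (complex \<times> complex \<Rightarrow> complex) \<Rightarrow> complex \<times> complex \<Rightarrow> complex" where
  "mixed_deriv m n f p =
     (deriv ^^ m) (\<lambda>\<zeta>1. (deriv ^^ n) (\<lambda>\<zeta>2. f (\<zeta>1, \<zeta>2)) (snd p)) (fst p)"

definition RC :: "nat \<Rightarrow> nat \<Rightarrow> nat \<Rightarrow> (complex \<times> complex \<Rightarrow> complex) \<Rightarrow> complex \<Rightarrow> complex" where
  "RC k1 k2 l f z =
     (\<Sum>j=0..l. (-1) ^ j * of_nat ((k1 + l - 1) choose j) * of_nat ((k2 + l - 1) choose (l - j))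
                * mixed_deriv (l - j) j f (z, z))"

text \<open>For weights \<open>k1, k2 \<ge> 1\<close> the subtraction in the exponent does not truncate.\<close>

definition RC_kernel :: "nat \<Rightarrow> nat \<Rightarrow> nat \<Rightarrow> complex \<Rightarrow> complex \<Rightarrow> complex \<Rightarrow> complex" where
  "RC_kernel k1 k2 l \<zeta>1 \<zeta>2 z =
     (\<zeta>1 - \<zeta>2) ^ (k1 + k2 + l - 2) / ((\<zeta>1 - z) ^ (k2 + l) * (\<zeta>2 - z) ^ (k1 + l))"

text \<open>Positively oriented contours in \<open>D\<close> around \<open>z\<close>. Vanishing of the winding numbers about the
  points outside \<open>D\<close> says that the contour does not enclose a hole of \<open>D\<close>; without it the
  integrals would depend on the contour. Simplicity of the path is not required.\<close>

definition contour_around :: "complex set \<Rightarrow> complex \<Rightarrow> (real \<Rightarrow> complex) \<Rightarrow> bool" where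
  "contour_around D z \<gamma> \<longleftrightarrow>
     valid_path \<gamma> \<and> pathfinish \<gamma> = pathstart \<gamma> \<and> path_image \<gamma> \<subseteq> D - {z} \<and>
     winding_number \<gamma> z = 1 \<and> (\<forall>w. w \<notin> D \<longrightarrow> winding_number \<gamma> w = 0)"

lemma contour_around_circlepath:
  assumes "r > 0" "cball z r \<subseteq> D"
  shows "contour_around D z (circlepath z r)"
proof -
  have "winding_number (circlepath z r) w = 0" if "w \<notin> D" for w
  proof (rule winding_number_zero_outside[where s = "cball z r"])
    show "path_image (circlepath z r) \<subseteq> cball z r"
      using assms(1) by (simp add: sphere_cball)
  qed (use assms that in auto)
  moreover have "path_image (circlepath z r) \<subseteq> D - {z}"
    using assms by (auto simp: subset_iff)
  moreover have "winding_number (circlepath z r) z = 1"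
    using assms(1) by (simp add: winding_number_circlepath_centre)
  ultimately show ?thesis
    by (simp add: contour_around_def)
qed

text \<open>The contours may vary with \<open>z\<close>: \<open>C1 z\<close> and \<open>C2 z\<close> are the contours used at the point \<open>z\<close>.\<close>

definition RC_integral :: "(complex \<Rightarrow> real \<Rightarrow> complex) \<Rightarrow> (complex \<Rightarrow> real \<Rightarrow> complex) \<Rightarrow>
    nat \<Rightarrow> nat \<Rightarrow> nat \<Rightarrow> (complex \<times> complex \<Rightarrow> complex) \<Rightarrow> complex \<Rightarrow> complex" where
  "RC_integral C1 C2 k1 k2 l f z =
     1 / (2 * of_real pi * \<i>)\<^sup>2 *
       contour_integral (C1 z) (\<lambda>\<zeta>1. contour_integral (C2 z) (\<lambda>\<zeta>2.
         RC_kernel k1 k2 l \<zeta>1 \<zeta>2 z * f (\<zeta>1, \<zeta>2)))"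

text \<open>\<open>L\<close> induces a complex linear map from the holomorphic functions on \<open>D \<times> D\<close> to those on \<open>D\<close>.
  Elements of these spaces are represented by total functions, of which only the values on
  \<open>D \<times> D\<close> and \<open>D\<close> count; the case \<open>a = 1\<close>, \<open>b = 0\<close> of the second clause says that \<open>L\<close> respects this.\<close>

definition linear_map_hol :: "complex set \<Rightarrow> ((complex \<times> complex \<Rightarrow> complex) \<Rightarrow> complex \<Rightarrow> complex) \<Rightarrow> bool" where
  "linear_map_hol D L \<longleftrightarrow>
     (\<forall>f. f holomorphic2_on D \<times> D \<longrightarrow> L f holomorphic_on D) \<and>
     (\<forall>f g h a b. f holomorphic2_on D \<times> D \<longrightarrow> g holomorphic2_on D \<times> D \<longrightarrow> h holomorphic2_on D \<times> D \<longrightarrow>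
        (\<forall>p\<in>D \<times> D. h p = a * f p + b * g p) \<longrightarrow> (\<forall>z\<in>D. L h z = a * L f z + b * L g z))"

end

theory Submission imports Defs begin

text \<open>
  Put \<open>\<zeta>1 - \<zeta>2 = (\<zeta>1 - z) - (\<zeta>2 - z)\<close> in the numerator of the kernel and expand by the binomial
  theorem. This turns the kernel into a finite sum of products of a power of \<open>\<zeta>1 - z\<close> and a power of
  \<open>\<zeta>2 - z\<close> (lemma \<open>RC_kernel_expansion\<close>), so the double integral splits into iterated one-variable
  Cauchy integrals. Each of these vanishes when the exponent is nonnegative and is a derivative at \<open>z\<close>
  when it is negative (lemma \<open>contour_around_has_contour_integral_Laurent\<close>). The exponents of the two
  variables in the \<open>i\<close>-th term are \<open>i - k2 - l\<close> and \<open>k2 - 2 - i\<close>; both are negative exactly for the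
  \<open>l + 1\<close> indices \<open>i = k2 - 1 + j\<close> with \<open>0 \<le> j \<le> l\<close>, and such a term yields the mixed derivative of
  order \<open>l - j\<close> in \<open>\<zeta>1\<close> and \<open>j\<close> in \<open>\<zeta>2\<close>. Its coefficient is, up to a factor independent of \<open>j\<close>, the
  Rankin--Cohen coefficient (lemma \<open>RC_coefficient_identity\<close>).

  The contours are arbitrary closed paths with winding number zero about every point outside \<open>D\<close>, so
  the Cauchy formula needed for derivatives is the homology version; it follows from the formula for
  the value itself by integration by parts.

  Two facts on functions of two variables enter: the inner integral must be holomorphic in \<open>\<zeta>1\<close>, and
  the bracket must be holomorphic in \<open>z\<close>. Both hold because every mixed derivative of a holomorphic
  function is again holomorphic on \<open>D \<times> D\<close>. The mechanism is Osgood's lemma: a continuous function that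
  is holomorphic in each variable is holomorphic, since the Cauchy integral makes its partial
  derivatives continuous. Finally, the integral operator inherits linearity and holomorphy of its values
  from the bracket, of which it is a constant multiple.
\<close>

section \<open>Holomorphic functions of two variables\<close>

lemma holomorphic2_imp_continuous_on:
  assumes "f holomorphic2_on U"
  shows "continuous_on U f"
  using assms unfolding holomorphic2_on_def continuous_on_eq_continuous_within
  by (blast intro: has_derivative_continuous)

lemma holomorphic2_imp_holomorphic_fst:
  assumes f: "f holomorphic2_on X \<times> Y" and y: "y \<in> Y"
  shows "(\<lambda>x. f (x, y)) holomorphic_on X"
  unfolding holomorphic_on_def field_differentiable_def
proof
  fix x assume x: "x \<in> X"
  then obtain a b where d: "(f has_derivative (\<lambda>h. a * fst h + b * snd h)) (at (x, y) within X \<times> Y)"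
    using f y unfolding holomorphic2_on_def by blast
  have inj: "((\<lambda>x. (x, y)) has_derivative (\<lambda>h. (h, 0))) (at x within X)"
    by (auto intro!: derivative_eq_intros)
  have "(f has_derivative (\<lambda>h. a * fst h + b * snd h)) (at (x, y) within (\<lambda>x. (x, y)) ` X)"
    by (rule has_derivative_subset[OF d]) (use y in auto)
  from has_derivative_in_compose[OF inj this]
  have "((\<lambda>x. f (x, y)) has_field_derivative a) (at x within X)"
    by (simp add: has_field_derivative_def)
  then show "\<exists>f'. ((\<lambda>x. f (x, y)) has_field_derivative f') (at x within X)" ..
qed

lemma holomorphic2_imp_holomorphic_snd:
  assumes f: "f holomorphic2_on X \<times> Y" and x: "x \<in> X"
  shows "(\<lambda>y. f (x, y)) holomorphic_on Y"
  unfolding holomorphic_on_def field_differentiable_def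
proof
  fix y assume y: "y \<in> Y"
  then obtain a b where d: "(f has_derivative (\<lambda>h. a * fst h + b * snd h)) (at (x, y) within X \<times> Y)"
    using f x unfolding holomorphic2_on_def by blast
  have inj: "((\<lambda>y. (x, y)) has_derivative (\<lambda>h. (0, h))) (at y within Y)"
    by (auto intro!: derivative_eq_intros)
  have "(f has_derivative (\<lambda>h. a * fst h + b * snd h)) (at (x, y) within (\<lambda>y. (x, y)) ` Y)"
    by (rule has_derivative_subset[OF d]) (use x in auto)
  from has_derivative_in_compose[OF inj this]
  have "((\<lambda>y. f (x, y)) has_field_derivative b) (at y within Y)"
    by (simp add: has_field_derivative_def)
  then show "\<exists>f'. ((\<lambda>y. f (x, y)) has_field_derivative f') (at y within Y)" ..
qed

text \<open>Written as an integral over a fixed compact interval, Cauchy's formula for the derivative lets the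
  general theorems on integrals with a parameter apply: the circle stays fixed while \<open>y\<close> moves inside it
  and \<open>g\<close> varies with a further variable.\<close>

lemma deriv_eq_integral_circlepath:
  assumes "0 < r" "cball y0 r \<subseteq> Y" "g holomorphic_on Y" "y \<in> ball y0 r"
  shows "deriv g y = 1 / (2 * of_real pi * \<i>) *
           integral (cbox 0 1) (\<lambda>t. g (circlepath y0 r t) / (circlepath y0 r t - y)\<^sup>2 *
                                  (2 * of_real pi * \<i> * of_real r * exp (2 * of_real pi * \<i> * of_real t)))"
proof -
  have "g holomorphic_on cball y0 r"
    using assms holomorphic_on_subset by blast
  then have "contour_integral (circlepath y0 r) (\<lambda>u. g u / (u - y)\<^sup>2) = (2 * pi * \<i>) * deriv g y"
    using assms
    by (intro Cauchy_contour_integral_circlepath_2 holomorphic_on_imp_continuous_on)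
       (auto intro: holomorphic_on_subset)
  then show ?thesis
    by (simp add: contour_integral_integral vector_derivative_circlepath)
qed

lemma circlepath_in_sphere: "0 < r \<Longrightarrow> circlepath z r t \<in> sphere z r"
  by (simp add: circlepath dist_norm norm_mult)

text \<open>Locally in \<open>y\<close>, the partial derivative is a Cauchy integral over one circle whose integrand is
  jointly continuous in the integration variable and both parameters.\<close>

lemma continuous_on_deriv_snd:
  fixes f :: "complex \<times> complex \<Rightarrow> complex"
  assumes Y: "open Y" and X: "open X" and cont: "continuous_on (X \<times> Y) f"
    and hol: "\<And>x. x \<in> X \<Longrightarrow> (\<lambda>y. f (x, y)) holomorphic_on Y"
  shows "continuous_on (X \<times> Y) (\<lambda>p. deriv (\<lambda>y. f (fst p, y)) (snd p))"
proof (intro continuous_at_imp_continuous_on ballI)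
  fix p assume "p \<in> X \<times> Y"
  then obtain x0 y0 where p: "p = (x0, y0)" and xy: "x0 \<in> X" "y0 \<in> Y"
    by blast
  obtain r where r: "0 < r" "cball y0 r \<subseteq> Y"
    using Y xy(2) by (meson open_contains_cball)
  define c where "c = circlepath y0 r"
  have cS: "c t \<in> sphere y0 r" for t
    unfolding c_def by (rule circlepath_in_sphere[OF r(1)])
  have cY: "c t \<in> Y" for t
    using cS[of t] r(2) sphere_cball by blast
  have contc: "continuous_on T c" for T
    unfolding c_def circlepath by (intro continuous_intros)
  have ne: "c t \<noteq> y" if "y \<in> ball y0 r" for t y
    using that cS[of t] by auto
  let ?U = "X \<times> ball y0 r"
  have "continuous_on ?U (\<lambda>p. 1 / (2 * of_real pi * \<i>) *
           integral (cbox 0 1) (\<lambda>t. f (fst p, c t) / (c t - snd p)\<^sup>2 *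
                                  (2 * of_real pi * \<i> * of_real r * exp (2 * of_real pi * \<i> * of_real t))))"
  proof (intro continuous_on_mult continuous_on_const integral_continuous_on_param)
    have "continuous_on (?U \<times> cbox 0 1) (\<lambda>q. f (fst (fst q), c (snd q)))"
      by (rule continuous_on_compose2[OF cont])
         (auto intro!: continuous_intros continuous_on_compose2[OF contc[of UNIV]] cY)
    then show "continuous_on (?U \<times> cbox 0 1) (\<lambda>(p, t). f (fst p, c t) / (c t - snd p)\<^sup>2 *
                 (2 * of_real pi * \<i> * of_real r * exp (2 * of_real pi * \<i> * of_real t)))"
      unfolding case_prod_unfold
      by (intro continuous_intros continuous_on_compose2[OF contc[of UNIV]]) (auto simp: ne)
  qed
  then have "continuous_on ?U (\<lambda>p. deriv (\<lambda>y. f (fst p, y)) (snd p))"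
    by (rule continuous_on_eq, unfold c_def, intro deriv_eq_integral_circlepath[OF r hol, symmetric]) auto
  moreover have "open ?U"
    using X by (intro open_Times) auto
  ultimately show "isCont (\<lambda>p. deriv (\<lambda>y. f (fst p, y)) (snd p)) p"
    using p xy r(1) by (auto simp: continuous_on_eq_continuous_at)
qed

lemma continuous_on_deriv_fst:
  fixes f :: "complex \<times> complex \<Rightarrow> complex"
  assumes X: "open X" and Y: "open Y" and cont: "continuous_on (X \<times> Y) f"
    and hol: "\<And>y. y \<in> Y \<Longrightarrow> (\<lambda>x. f (x, y)) holomorphic_on X"
  shows "continuous_on (X \<times> Y) (\<lambda>p. deriv (\<lambda>x. f (x, snd p)) (fst p))"
proof -
  have "continuous_on (Y \<times> X) (\<lambda>p. f (prod.swap p))"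
    by (rule continuous_on_compose2[OF cont]) (auto intro: continuous_on_swap)
  then have "continuous_on (Y \<times> X) (\<lambda>p. deriv (\<lambda>x. f (prod.swap (fst p, x))) (snd p))"
    by (intro continuous_on_deriv_snd X Y) (auto intro: hol)
  then have "continuous_on (X \<times> Y) (\<lambda>q. deriv (\<lambda>x. f (prod.swap (fst (prod.swap q), x))) (snd (prod.swap q)))"
    by (rule continuous_on_compose2) (auto intro: continuous_on_swap)
  then show ?thesis by simp
qed

text \<open>One partial derivative exists at the point and the other one is continuous near it, which is enough
  for joint differentiability.\<close>

lemma Osgood_holomorphic2_on:
  fixes f :: "complex \<times> complex \<Rightarrow> complex"
  assumes X: "open X" and Y: "open Y" and cont: "continuous_on (X \<times> Y) f"
    and hol1: "\<And>y. y \<in> Y \<Longrightarrow> (\<lambda>x. f (x, y)) holomorphic_on X"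
    and hol2: "\<And>x. x \<in> X \<Longrightarrow> (\<lambda>y. f (x, y)) holomorphic_on Y"
  shows "f holomorphic2_on X \<times> Y"
  unfolding holomorphic2_on_def
proof safe
  fix x0 y0 assume xy: "x0 \<in> X" "y0 \<in> Y"
  obtain r where r: "0 < r" "ball y0 r \<subseteq> Y"
    using Y xy(2) by (meson open_contains_ball)
  define a where "a = deriv (\<lambda>x. f (x, y0)) x0"
  define b where "b = (\<lambda>x y. deriv (\<lambda>y. f (x, y)) y)"
  let ?V = "X \<times> ball y0 r"
  have "((\<lambda>(x, y). f (x, y)) has_derivative
          (\<lambda>(tx, ty). a * tx + blinfun_apply (blinfun_mult_right (b x0 y0)) ty)) (at (x0, y0) within ?V)"
  proof (rule has_derivative_partialsI)
    show "((\<lambda>x. f (x, y0)) has_derivative (\<lambda>h. a * h)) (at x0 within X)"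
      using holomorphic_derivI[OF hol1[OF xy(2)] X xy(1)]
      unfolding a_def has_field_derivative_def by (rule has_derivative_at_withinI)
    show "((\<lambda>y. f (x, y)) has_derivative blinfun_apply (blinfun_mult_right (b x y))) (at y within ball y0 r)"
      if "x \<in> X" "y \<in> ball y0 r" for x y
      using holomorphic_derivI[OF hol2[OF that(1)] Y, of y] that(2) r(2)
      unfolding b_def has_field_derivative_def blinfun_mult_right.rep_eq
      by (auto intro: has_derivative_at_withinI)
    have "continuous_on (X \<times> Y) (\<lambda>p. b (fst p) (snd p))"
      unfolding b_def by (rule continuous_on_deriv_snd[OF Y X cont hol2])
    then have "continuous_on (X \<times> Y) (\<lambda>p. blinfun_mult_right (b (fst p) (snd p)))"
      by (rule bounded_linear.continuous_on[OF bounded_linear_blinfun_mult_right])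
    then have "isCont (\<lambda>p. blinfun_mult_right (b (fst p) (snd p))) (x0, y0)"
      using xy open_Times[OF X Y] by (auto simp: continuous_on_eq_continuous_at)
    then show "continuous (at (x0, y0) within ?V) (\<lambda>(x, y). blinfun_mult_right (b x y))"
      unfolding case_prod_unfold by (rule continuous_at_imp_continuous_at_within)
  qed (use r in auto)
  moreover have "at (x0, y0) within ?V = at (x0, y0) within X \<times> Y"
    using at_within_open[OF _ open_Times[OF X open_ball], of "(x0, y0)" y0 r]
      at_within_open[OF _ open_Times[OF X Y], of "(x0, y0)"] xy r(1) by simp
  ultimately have "(f has_derivative (\<lambda>h. a * fst h + b x0 y0 * snd h)) (at (x0, y0) within X \<times> Y)"
    by (simp add: case_prod_unfold blinfun_mult_right.rep_eq)
  then show "\<exists>a b. (f has_derivative (\<lambda>h. a * fst h + b * snd h)) (at (x0, y0) within X \<times> Y)"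
    by blast
qed

text \<open>Differentiate the Cauchy integral for \<open>\<partial>f/\<partial>y\<close> under the integral sign; the continuity of
  \<open>\<partial>f/\<partial>x\<close> justifies this.\<close>

lemma holomorphic_on_deriv_snd_param:
  assumes X: "open X" and Y: "open Y" and f: "f holomorphic2_on X \<times> Y" and y: "y \<in> Y"
  shows "(\<lambda>x. deriv (\<lambda>w. f (x, w)) y) holomorphic_on X"
proof -
  note cont = holomorphic2_imp_continuous_on[OF f]
  note hol1 = holomorphic2_imp_holomorphic_fst[OF f]
  note hol2 = holomorphic2_imp_holomorphic_snd[OF f]
  obtain r where r: "0 < r" "cball y r \<subseteq> Y"
    using Y y by (meson open_contains_cball)
  define c where "c = circlepath y r"
  define k where "k = (\<lambda>t::real. 2 * of_real pi * \<i> * of_real r * exp (2 * of_real pi * \<i> * of_real t))"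
  have cS: "c t \<in> sphere y r" for t
    unfolding c_def by (rule circlepath_in_sphere[OF r(1)])
  have cY: "c t \<in> Y" for t
    using cS[of t] r(2) sphere_cball by blast
  have ne: "c t \<noteq> y" for t
    using cS[of t] r(1) by auto
  have contc: "continuous_on T c" for T
    unfolding c_def circlepath by (intro continuous_intros)
  have contk: "continuous_on T k" for T
    unfolding k_def by (intro continuous_intros)
  have local: "(\<lambda>x. deriv (\<lambda>w. f (x, w)) y) holomorphic_on ball x0 s"
    if s: "ball x0 s \<subseteq> X" for x0 s
  proof -
    let ?B = "ball x0 s"
    have "(\<lambda>x. integral (cbox 0 1) (\<lambda>t. f (x, c t) / (c t - y)\<^sup>2 * k t)) holomorphic_on ?B"
    proof (rule leibniz_rule_holomorphic)
      show "((\<lambda>x. f (x, c t) / (c t - y)\<^sup>2 * k t) has_field_derivative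
              deriv (\<lambda>x. f (x, c t)) x / (c t - y)\<^sup>2 * k t) (at x within ?B)"
        if "x \<in> ?B" for x t
        using holomorphic_derivI[OF hol1[OF cY[of t]] X, of x] that s
        by (intro DERIV_cmult_right DERIV_cdivide) (auto intro: has_field_derivative_at_within)
      show "(\<lambda>t. f (x, c t) / (c t - y)\<^sup>2 * k t) integrable_on cbox 0 1" if "x \<in> ?B" for x
      proof (rule integrable_continuous)
        have "continuous_on (cbox 0 1) (\<lambda>t. f (x, c t))"
          by (rule continuous_on_compose2[OF cont])
             (use that s in \<open>auto intro!: continuous_intros contc cY\<close>)
        then show "continuous_on (cbox 0 1) (\<lambda>t. f (x, c t) / (c t - y)\<^sup>2 * k t)"
          by (intro continuous_intros contc contk) (auto simp: ne)
      qed
      have "continuous_on (?B \<times> cbox 0 1)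
              (\<lambda>q. deriv (\<lambda>x. f (x, snd (fst q, c (snd q)))) (fst (fst q, c (snd q))))"
        by (rule continuous_on_compose2[OF continuous_on_deriv_fst[OF X Y cont hol1]])
           (use s in \<open>auto intro!: continuous_intros continuous_on_compose2[OF contc[of UNIV]] cY\<close>)
      then show "continuous_on (?B \<times> cbox 0 1) (\<lambda>(x, t). deriv (\<lambda>x. f (x, c t)) x / (c t - y)\<^sup>2 * k t)"
        unfolding case_prod_unfold
        by (intro continuous_intros continuous_on_compose2[OF contc[of UNIV]]
                  continuous_on_compose2[OF contk[of UNIV]]) (auto simp: ne)
    qed auto
    then have "(\<lambda>x. 1 / (2 * of_real pi * \<i>) * integral (cbox 0 1) (\<lambda>t. f (x, c t) / (c t - y)\<^sup>2 * k t))
                 holomorphic_on ?B"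
      by (intro holomorphic_intros)
    then show ?thesis
      by (rule holomorphic_transform, unfold c_def k_def,
          intro deriv_eq_integral_circlepath[OF r hol2, symmetric]) (use s r in auto)
  qed
  show ?thesis
  proof (rule holomorphic_on_open[OF X, THEN iffD2], intro ballI)
    fix x assume "x \<in> X"
    then obtain s where "0 < s" "ball x s \<subseteq> X"
      using X by (meson open_contains_ball)
    then show "\<exists>f'. ((\<lambda>x. deriv (\<lambda>w. f (x, w)) y) has_field_derivative f') (at x)"
      using holomorphic_derivI[OF local open_ball, of x s x] by auto
  qed
qed

lemma holomorphic2_on_deriv_snd:
  assumes X: "open X" and Y: "open Y" and f: "f holomorphic2_on X \<times> Y"
  shows "(\<lambda>p. deriv (\<lambda>w. f (fst p, w)) (snd p)) holomorphic2_on X \<times> Y"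
proof (rule Osgood_holomorphic2_on[OF X Y])
  show "continuous_on (X \<times> Y) (\<lambda>p. deriv (\<lambda>w. f (fst p, w)) (snd p))"
    by (intro continuous_on_deriv_snd X Y holomorphic2_imp_continuous_on[OF f]
              holomorphic2_imp_holomorphic_snd[OF f])
  show "(\<lambda>x. deriv (\<lambda>w. f (fst (x, y), w)) (snd (x, y))) holomorphic_on X" if "y \<in> Y" for y
    using holomorphic_on_deriv_snd_param[OF X Y f that] by simp
  show "(\<lambda>y. deriv (\<lambda>w. f (fst (x, y), w)) (snd (x, y))) holomorphic_on Y" if "x \<in> X" for x
    using holomorphic_deriv[OF holomorphic2_imp_holomorphic_snd[OF f that] Y] by simp
qed

lemma holomorphic2_on_swap:
  assumes X: "open X" and Y: "open Y" and f: "f holomorphic2_on X \<times> Y"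
  shows "(\<lambda>p. f (prod.swap p)) holomorphic2_on Y \<times> X"
proof (rule Osgood_holomorphic2_on[OF Y X])
  show "continuous_on (Y \<times> X) (\<lambda>p. f (prod.swap p))"
    by (rule continuous_on_compose2[OF holomorphic2_imp_continuous_on[OF f]])
       (auto intro: continuous_on_swap)
qed (auto intro: holomorphic2_imp_holomorphic_fst[OF f] holomorphic2_imp_holomorphic_snd[OF f])

lemma holomorphic2_on_deriv_fst:
  assumes X: "open X" and Y: "open Y" and f: "f holomorphic2_on X \<times> Y"
  shows "(\<lambda>p. deriv (\<lambda>w. f (w, snd p)) (fst p)) holomorphic2_on X \<times> Y"
  using holomorphic2_on_swap[OF Y X holomorphic2_on_deriv_snd[OF Y X holomorphic2_on_swap[OF X Y f]]]
  by simp

lemma holomorphic2_on_higher_deriv_snd: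
  assumes "open X" "open Y" "f holomorphic2_on X \<times> Y"
  shows "(\<lambda>p. (deriv ^^ n) (\<lambda>w. f (fst p, w)) (snd p)) holomorphic2_on X \<times> Y"
proof (induction n)
  case (Suc n)
  from holomorphic2_on_deriv_snd[OF assms(1,2) this] show ?case by simp
qed (use assms in simp)

lemma holomorphic2_on_mixed_deriv:
  assumes "open X" "open Y" "f holomorphic2_on X \<times> Y"
  shows "mixed_deriv m n f holomorphic2_on X \<times> Y"
proof (induction m)
  case 0
  show ?case
    using holomorphic2_on_higher_deriv_snd[OF assms] by (simp add: mixed_deriv_def[abs_def])
next
  case (Suc m)
  from holomorphic2_on_deriv_fst[OF assms(1,2) this] show ?case
    by (simp add: mixed_deriv_def[abs_def])
qed

lemma holomorphic_on_diagonal: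
  assumes f: "f holomorphic2_on D \<times> D"
  shows "(\<lambda>z. f (z, z)) holomorphic_on D"
  unfolding holomorphic_on_def field_differentiable_def
proof
  fix z assume z: "z \<in> D"
  then obtain a b where d: "(f has_derivative (\<lambda>h. a * fst h + b * snd h)) (at (z, z) within D \<times> D)"
    using f unfolding holomorphic2_on_def by blast
  have inj: "((\<lambda>z. (z, z)) has_derivative (\<lambda>h. (h, h))) (at z within D)"
    by (auto intro!: derivative_eq_intros)
  have "(f has_derivative (\<lambda>h. a * fst h + b * snd h)) (at (z, z) within (\<lambda>z. (z, z)) ` D)"
    by (rule has_derivative_subset[OF d]) auto
  from has_derivative_in_compose[OF inj this]
  have "((\<lambda>z. f (z, z)) has_derivative (\<lambda>h. (a + b) * h)) (at z within D)"
    by (simp add: algebra_simps)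
  then show "\<exists>f'. ((\<lambda>z. f (z, z)) has_field_derivative f') (at z within D)"
    unfolding has_field_derivative_def by blast
qed

text \<open>The hypothesis on \<open>h\<close> is confined to \<open>S\<close> because a holomorphic function on \<open>S\<close> is represented by a
  total function with irrelevant values elsewhere.\<close>

lemma higher_deriv_linear_combination:
  assumes "open S" "f holomorphic_on S" "g holomorphic_on S" "z \<in> S"
    and "\<And>w. w \<in> S \<Longrightarrow> h w = a * f w + b * g w"
  shows "(deriv ^^ n) h z = a * (deriv ^^ n) f z + b * (deriv ^^ n) g z"
proof -
  have "(deriv ^^ n) h z = (deriv ^^ n) (\<lambda>w. a * f w + b * g w) z"
    using assms eventually_nhds_in_open[OF assms(1,4)]
    by (intro higher_deriv_cong_ev) (auto elim!: eventually_mono)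
  also have "\<dots> = (deriv ^^ n) (\<lambda>w. a * f w) z + (deriv ^^ n) (\<lambda>w. b * g w) z"
    using assms by (intro higher_deriv_add[where S = S] holomorphic_intros)
  also have "\<dots> = a * (deriv ^^ n) f z + b * (deriv ^^ n) g z"
    using assms by (simp add: higher_deriv_cmult[where A = S])
  finally show ?thesis .
qed

lemma mixed_deriv_linear_combination:
  assumes X: "open X" and Y: "open Y" and f: "f holomorphic2_on X \<times> Y" and g: "g holomorphic2_on X \<times> Y"
    and h: "\<And>p. p \<in> X \<times> Y \<Longrightarrow> h p = a * f p + b * g p" and p: "p \<in> X \<times> Y"
  shows "mixed_deriv m n h p = a * mixed_deriv m n f p + b * mixed_deriv m n g p"
proof -
  have p': "fst p \<in> X" "snd p \<in> Y" using p by auto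
  have param: "(\<lambda>x. (deriv ^^ n) (\<lambda>w. F (x, w)) (snd p)) holomorphic_on X"
    if "F holomorphic2_on X \<times> Y" for F
    using holomorphic2_imp_holomorphic_fst[OF holomorphic2_on_higher_deriv_snd[OF X Y that] p'(2)] by simp
  show ?thesis
    unfolding mixed_deriv_def
  proof (rule higher_deriv_linear_combination[OF X param[OF f] param[OF g] p'(1)])
    fix x assume x: "x \<in> X"
    show "(deriv ^^ n) (\<lambda>w. h (x, w)) (snd p) =
            a * (deriv ^^ n) (\<lambda>w. f (x, w)) (snd p) + b * (deriv ^^ n) (\<lambda>w. g (x, w)) (snd p)"
      using x h
      by (intro higher_deriv_linear_combination[OF Y _ _ p'(2)] holomorphic2_imp_holomorphic_snd[OF f]
            holomorphic2_imp_holomorphic_snd[OF g]) auto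
  qed
qed

lemma linear_map_hol_RC:
  assumes "open D"
  shows "linear_map_hol D (RC k1 k2 l)"
  unfolding linear_map_hol_def
proof (intro conjI allI impI ballI)
  fix f assume f: "f holomorphic2_on D \<times> D"
  show "RC k1 k2 l f holomorphic_on D"
    unfolding RC_def[abs_def]
    by (intro holomorphic_intros holomorphic_on_diagonal holomorphic2_on_mixed_deriv assms f)
next
  fix f g h a b z
  assume f: "f holomorphic2_on D \<times> D" and g: "g holomorphic2_on D \<times> D"
    and h: "\<forall>p\<in>D \<times> D. h p = a * f p + b * g p" and z: "z \<in> D"
  have "mixed_deriv m n h (z, z) = a * mixed_deriv m n f (z, z) + b * mixed_deriv m n g (z, z)" for m n
    by (rule mixed_deriv_linear_combination[OF assms assms f g]) (use h z in auto)
  then show "RC k1 k2 l h z = a * RC k1 k2 l f z + b * RC k1 k2 l g z"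
    by (simp add: RC_def sum_distrib_left sum.distrib[symmetric] algebra_simps)
qed

section \<open>Cauchy's formula for higher derivatives along a contour\<close>

text \<open>Integration by parts: \<open>h / (w - z)^(n+1)\<close> is holomorphic near the contour, so its derivative has
  integral zero along the closed path. This trades one power of \<open>w - z\<close> in the denominator for one
  derivative of \<open>h\<close>, down to the global Cauchy integral formula.\<close>

lemma contour_around_has_contour_integral_higher_deriv:
  assumes D: "open D" "z \<in> D" and \<gamma>: "contour_around D z \<gamma>" and "h holomorphic_on D"
  shows "((\<lambda>w. h w / (w - z) ^ Suc n) has_contour_integral
            2 * of_real pi * \<i> / fact n * (deriv ^^ n) h z) \<gamma>"
  using assms(4)
proof (induction n arbitrary: h)
  case 0
  then show ?case
    using Cauchy_integral_formula_global[OF D(1) 0 D(2), of \<gamma>] \<gamma>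
    by (simp add: contour_around_def)
next
  case (Suc n)
  let ?c = "of_nat (Suc n) :: complex"
  have 1: "((\<lambda>w. deriv h w / (w - z) ^ Suc n - ?c * (h w / (w - z) ^ Suc (Suc n)))
          has_contour_integral 0) \<gamma>"
  proof (rule Cauchy_theorem_primitive)
    fix w assume w: "w \<in> D - {z}"
    have "(h has_field_derivative deriv h w) (at w)"
      using holomorphic_derivI[OF Suc.prems D(1)] w by blast
    moreover have "((\<lambda>w. (w - z) ^ Suc n) has_field_derivative ?c * (w - z) ^ n) (at w)"
      by (rule derivative_eq_intros refl | simp)+
    ultimately have "((\<lambda>w. h w / (w - z) ^ Suc n) has_field_derivative
            (deriv h w * (w - z) ^ Suc n - h w * (?c * (w - z) ^ n)) / ((w - z) ^ Suc n * (w - z) ^ Suc n)) (at w)"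
      using w by (intro DERIV_divide) auto
    also have "(deriv h w * (w - z) ^ Suc n - h w * (?c * (w - z) ^ n)) / ((w - z) ^ Suc n * (w - z) ^ Suc n)
        = deriv h w / (w - z) ^ Suc n - ?c * (h w / (w - z) ^ Suc (Suc n))"
      using w by (simp add: divide_simps) (simp add: algebra_simps)
    finally show "((\<lambda>w. h w / (w - z) ^ Suc n) has_field_derivative
            deriv h w / (w - z) ^ Suc n - ?c * (h w / (w - z) ^ Suc (Suc n))) (at w within D - {z})"
      by (rule has_field_derivative_at_within)
  qed (use \<gamma> in \<open>auto simp: contour_around_def\<close>)
  have 2: "((\<lambda>w. deriv h w / (w - z) ^ Suc n) has_contour_integral
            2 * of_real pi * \<i> / fact n * (deriv ^^ n) (deriv h) z) \<gamma>"
    by (intro Suc.IH holomorphic_deriv Suc.prems D)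
  have "((\<lambda>w. ?c * (h w / (w - z) ^ Suc (Suc n))) has_contour_integral
            2 * of_real pi * \<i> / fact n * (deriv ^^ n) (deriv h) z) \<gamma>"
    using has_contour_integral_diff[OF 2 1] by simp
  from has_contour_integral_lmul[OF this, of "1 / ?c"]
  show ?case
    by (simp add: funpow_swap1 del: of_nat_Suc power_Suc)
qed

text \<open>The two cases are the derivative formula after cancelling \<open>(w - z)^a\<close>, and Cauchy's theorem for an
  integrand without singularity at \<open>z\<close>. The integrand keeps the uncancelled quotient, so that the summands
  of the expanded kernel are all covered at once.\<close>

lemma contour_around_has_contour_integral_Laurent:
  assumes D: "open D" "z \<in> D" and \<gamma>: "contour_around D z \<gamma>" and h: "h holomorphic_on D"
  shows "((\<lambda>w. (w - z) ^ a / (w - z) ^ b * h w) has_contour_integral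
            (if a < b then 2 * of_real pi * \<i> / fact (b - 1 - a) * (deriv ^^ (b - 1 - a)) h z else 0)) \<gamma>"
proof (cases "a < b")
  case True
  have "((\<lambda>w. (w - z) ^ a / (w - z) ^ b * h w) has_contour_integral
            2 * of_real pi * \<i> / fact (b - 1 - a) * (deriv ^^ (b - 1 - a)) h z) \<gamma>"
  proof (rule has_contour_integral_eq[OF contour_around_has_contour_integral_higher_deriv[OF D \<gamma> h]])
    fix w assume "w \<in> path_image \<gamma>"
    then have "w - z \<noteq> 0"
      using \<gamma> by (auto simp: contour_around_def)
    moreover have "(w - z) ^ b = (w - z) ^ Suc (b - 1 - a) * (w - z) ^ a"
      unfolding power_add[symmetric] using True by simp
    ultimately show "h w / (w - z) ^ Suc (b - 1 - a) = (w - z) ^ a / (w - z) ^ b * h w"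
      by (simp del: power_Suc)
  qed
  then show ?thesis using True by simp
next
  case False
  have "((\<lambda>w. (w - z) ^ (a - b) * h w) has_contour_integral 0) \<gamma>"
    using \<gamma> by (intro Cauchy_theorem_global[OF D(1)] holomorphic_intros h) (auto simp: contour_around_def)
  then have "((\<lambda>w. (w - z) ^ a / (w - z) ^ b * h w) has_contour_integral 0) \<gamma>"
  proof (rule has_contour_integral_eq)
    fix w assume "w \<in> path_image \<gamma>"
    then have "w - z \<noteq> 0"
      using \<gamma> by (auto simp: contour_around_def)
    then show "(w - z) ^ (a - b) * h w = (w - z) ^ a / (w - z) ^ b * h w"
      using False by (simp add: power_diff)
  qed
  then show ?thesis using False by simp
qed

section \<open>Evaluation of the integral operator\<close>

lemma RC_kernel_expansion:
  "RC_kernel (Suc p) (Suc q) l w1 w2 z =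
     (\<Sum>i\<le>p + q + l. of_nat ((p + q + l) choose i) * (-1) ^ (p + q + l - i) *
        ((w1 - z) ^ i / (w1 - z) ^ (Suc q + l)) *
        ((w2 - z) ^ (p + q + l - i) / (w2 - z) ^ (Suc p + l)))"
proof -
  have "(w1 - w2) ^ (p + q + l) = ((w1 - z) + - (w2 - z)) ^ (p + q + l)"
    by simp
  also have "\<dots> = (\<Sum>i\<le>p + q + l. of_nat ((p + q + l) choose i) * (w1 - z) ^ i * (- (w2 - z)) ^ (p + q + l - i))"
    by (rule binomial_ring)
  also have "\<dots> = (\<Sum>i\<le>p + q + l. of_nat ((p + q + l) choose i) * (-1) ^ (p + q + l - i) *
        (w1 - z) ^ i * (w2 - z) ^ (p + q + l - i))"
    by (intro sum.cong refl) (simp add: power_minus[of "w2 - z"] del: minus_diff_eq)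
  finally show ?thesis
    by (simp add: RC_kernel_def sum_divide_distrib)
qed

text \<open>The left side is the coefficient which the integral produces in front of a mixed derivative.
  Its denominator is \<open>(q + j)! (p + l - j)! (l - j)! j!\<close>; pairing \<open>j!\<close> with \<open>(p + l - j)!\<close> and \<open>(l - j)!\<close>
  with \<open>(q + j)!\<close> gives the two binomial coefficients of the bracket.\<close>

lemma RC_coefficient_identity:
  assumes "j \<le> l"
  shows "of_nat ((p + q + l) choose (q + j)) * (-1) ^ (p + l - j) / (fact (l - j) * fact j) =
         ((-1) ^ (p + l) * fact (p + q + l) / (fact (p + l) * fact (q + l)) *
          ((-1) ^ j * of_nat ((p + l) choose j) * of_nat ((q + l) choose (l - j))) :: complex)"
proof -
  have outer: "(of_nat ((p + q + l) choose (q + j)) :: complex) =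
      fact (p + q + l) / (fact (q + j) * fact (p + l - j))"
    using assms by (subst binomial_fact) auto
  have left: "(of_nat ((p + l) choose j) :: complex) = fact (p + l) / (fact j * fact (p + l - j))"
    using assms by (subst binomial_fact) auto
  have right: "(of_nat ((q + l) choose (l - j)) :: complex) = fact (q + l) / (fact (l - j) * fact (q + j))"
    using assms by (subst binomial_fact) auto
  have sign: "(-1 :: complex) ^ (p + l - j) = (-1) ^ (p + l) * (-1) ^ j"
    using assms by (simp add: minus_one_power_iff)
  show ?thesis
    unfolding outer left right sign by (simp add: field_simps)
qed

text \<open>With the weights written as \<open>p + 1\<close> and \<open>q + 1\<close>, the subtractions in the constants disappear. The
  proof integrates the expanded kernel termwise, first over \<open>\<zeta>2\<close>, then over \<open>\<zeta>1\<close>.\<close>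

lemma RC_integral_eq_RC_Suc:
  assumes D: "open D" "z \<in> D"
    and C1: "contour_around D z (C1 z)" and C2: "contour_around D z (C2 z)"
    and f: "f holomorphic2_on D \<times> D"
  shows "RC_integral C1 C2 (Suc p) (Suc q) l f z =
           (-1) ^ (p + l) * fact (p + q + l) / (fact (p + l) * fact (q + l)) * RC (Suc p) (Suc q) l f z"
proof -
  define N where "N = p + q + l"
  define c where "c = (\<lambda>i. of_nat (N choose i) * (-1) ^ (N - i) :: complex)"
  define \<tau> where "\<tau> = 2 * of_real pi * \<i>"
  define G where "G = (\<lambda>n x. (deriv ^^ n) (\<lambda>w. f (x, w)) z)"
  have G: "G n holomorphic_on D" for n
    using holomorphic2_imp_holomorphic_fst[OF holomorphic2_on_higher_deriv_snd[OF D(1) D(1) f] D(2)]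
    by (simp add: G_def)
  \<comment> \<open>the inner integral of the \<open>i\<close>-th term, as a function of the outer variable\<close>
  define u where "u = (\<lambda>i x. if N - i < Suc p + l
      then \<tau> / fact (Suc p + l - 1 - (N - i)) * G (Suc p + l - 1 - (N - i)) x else 0)"
  have u: "u i holomorphic_on D" for i
    unfolding u_def by (cases "N - i < Suc p + l") (auto intro!: holomorphic_intros G)
  have inner: "contour_integral (C2 z) (\<lambda>w2. RC_kernel (Suc p) (Suc q) l w1 w2 z * f (w1, w2)) =
      (\<Sum>i\<le>N. c i * ((w1 - z) ^ i / (w1 - z) ^ (Suc q + l) * u i w1))"
    if w1: "w1 \<in> D" for w1
  proof (rule contour_integral_unique)
    have "((\<lambda>w2. \<Sum>i\<le>N. c i * ((w1 - z) ^ i / (w1 - z) ^ (Suc q + l)) *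
              ((w2 - z) ^ (N - i) / (w2 - z) ^ (Suc p + l) * f (w1, w2))) has_contour_integral
            (\<Sum>i\<le>N. c i * ((w1 - z) ^ i / (w1 - z) ^ (Suc q + l)) * u i w1)) (C2 z)"
      unfolding u_def \<tau>_def G_def
      by (intro has_contour_integral_sum finite_atMost has_contour_integral_lmul
            contour_around_has_contour_integral_Laurent[OF D C2] holomorphic2_imp_holomorphic_snd[OF f w1])
    then show "((\<lambda>w2. RC_kernel (Suc p) (Suc q) l w1 w2 z * f (w1, w2)) has_contour_integral
          (\<Sum>i\<le>N. c i * ((w1 - z) ^ i / (w1 - z) ^ (Suc q + l) * u i w1))) (C2 z)"
      unfolding RC_kernel_expansion c_def N_def by (simp add: sum_distrib_right mult.assoc)
  qed
  have pathD: "path_image (C1 z) \<subseteq> D"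
    using C1 by (auto simp: contour_around_def)
  have "contour_integral (C1 z) (\<lambda>w1. contour_integral (C2 z) (\<lambda>w2.
            RC_kernel (Suc p) (Suc q) l w1 w2 z * f (w1, w2))) =
        contour_integral (C1 z) (\<lambda>w1. \<Sum>i\<le>N. c i * ((w1 - z) ^ i / (w1 - z) ^ (Suc q + l) * u i w1))"
    by (rule contour_integral_eq) (use pathD inner in blast)
  also have "\<dots> = (\<Sum>i\<le>N. c i * (if i < Suc q + l
      then \<tau> / fact (Suc q + l - 1 - i) * (deriv ^^ (Suc q + l - 1 - i)) (u i) z else 0))"
    unfolding \<tau>_def
    by (intro contour_integral_unique has_contour_integral_sum finite_atMost has_contour_integral_lmul
          contour_around_has_contour_integral_Laurent[OF D C1] u)
  also have "\<dots> = (\<Sum>i = q..q + l. c i * (\<tau> / fact (q + l - i) * (deriv ^^ (q + l - i)) (u i) z))"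
  proof (rule sum.mono_neutral_cong_right)
    show "\<forall>i\<in>{..N} - {q..q + l}. c i * (if i < Suc q + l
      then \<tau> / fact (Suc q + l - 1 - i) * (deriv ^^ (Suc q + l - 1 - i)) (u i) z else 0) = 0"
    proof
      fix i assume i: "i \<in> {..N} - {q..q + l}"
      show "c i * (if i < Suc q + l
        then \<tau> / fact (Suc q + l - 1 - i) * (deriv ^^ (Suc q + l - 1 - i)) (u i) z else 0) = 0"
      \<comment> \<open>below \<open>q\<close> the inner integrand is regular at \<open>z\<close>, above \<open>q + l\<close> the outer one is\<close>
      proof (cases "i < q")
        case True
        then have "u i = (\<lambda>x. 0)"
          by (simp add: u_def N_def fun_eq_iff)
        then show ?thesis by simp
      next
        case False
        then show ?thesis using i by auto
      qed
    qed
  qed (auto simp: N_def)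
  also have "\<dots> = (\<Sum>j = 0..l. c (q + j) * (\<tau> / fact (l - j) * (deriv ^^ (l - j)) (u (q + j)) z))"
    using sum.shift_bounds_cl_nat_ivl[of "\<lambda>i. c i * (\<tau> / fact (q + l - i) * (deriv ^^ (q + l - i)) (u i) z)" 0 q l]
    by (simp add: add.commute)
  also have "\<dots> = (\<Sum>j = 0..l. \<tau>\<^sup>2 * (c (q + j) / (fact (l - j) * fact j) * mixed_deriv (l - j) j f (z, z)))"
  proof (intro sum.cong refl)
    fix j assume j: "j \<in> {0..l}"
    then have "u (q + j) = (\<lambda>x. \<tau> / fact j * G j x)"
      by (simp add: u_def N_def fun_eq_iff)
    then have "(deriv ^^ (l - j)) (u (q + j)) z = \<tau> / fact j * (deriv ^^ (l - j)) (G j) z"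
      by (simp only: higher_deriv_cmult[OF G D(2,1)])
    also have "(deriv ^^ (l - j)) (G j) z = mixed_deriv (l - j) j f (z, z)"
      by (simp add: mixed_deriv_def G_def)
    finally show "c (q + j) * (\<tau> / fact (l - j) * (deriv ^^ (l - j)) (u (q + j)) z) =
        \<tau>\<^sup>2 * (c (q + j) / (fact (l - j) * fact j) * mixed_deriv (l - j) j f (z, z))"
      by (simp add: power2_eq_square)
  qed
  also have "\<dots> = \<tau>\<^sup>2 * (\<Sum>j = 0..l. c (q + j) / (fact (l - j) * fact j) * mixed_deriv (l - j) j f (z, z))"
    by (simp only: sum_distrib_left)
  finally have "RC_integral C1 C2 (Suc p) (Suc q) l f z =
      (\<Sum>j = 0..l. c (q + j) / (fact (l - j) * fact j) * mixed_deriv (l - j) j f (z, z))"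
    by (simp add: RC_integral_def \<tau>_def)
  also have "\<dots> = (\<Sum>j = 0..l. (-1) ^ (p + l) * fact (p + q + l) / (fact (p + l) * fact (q + l)) *
          ((-1) ^ j * of_nat ((p + l) choose j) * of_nat ((q + l) choose (l - j))) *
          mixed_deriv (l - j) j f (z, z))"
  proof (intro sum.cong refl)
    fix j assume j: "j \<in> {0..l}"
    have "N - (q + j) = p + l - j"
      by (simp add: N_def)
    then show "c (q + j) / (fact (l - j) * fact j) * mixed_deriv (l - j) j f (z, z) =
        (-1) ^ (p + l) * fact (p + q + l) / (fact (p + l) * fact (q + l)) *
          ((-1) ^ j * of_nat ((p + l) choose j) * of_nat ((q + l) choose (l - j))) *
          mixed_deriv (l - j) j f (z, z)"
      using RC_coefficient_identity[of j l p q] j by (simp add: c_def N_def)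
  qed
  also have "\<dots> = (-1) ^ (p + l) * fact (p + q + l) / (fact (p + l) * fact (q + l)) * RC (Suc p) (Suc q) l f z"
    by (simp add: RC_def sum_distrib_left mult.assoc)
  finally show ?thesis .
qed

lemma linear_map_hol_scaled:
  assumes L: "linear_map_hol D L"
    and eq: "\<And>f z. f holomorphic2_on D \<times> D \<Longrightarrow> z \<in> D \<Longrightarrow> T f z = c * L f z"
  shows "linear_map_hol D T"
  unfolding linear_map_hol_def
proof (intro conjI allI impI ballI)
  fix f assume f: "f holomorphic2_on D \<times> D"
  have "(\<lambda>z. c * L f z) holomorphic_on D"
    using L f by (auto simp: linear_map_hol_def intro: holomorphic_intros)
  then show "T f holomorphic_on D"
    by (rule holomorphic_transform) (simp add: eq f)
next
  fix f g h a b z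
  assume f: "f holomorphic2_on D \<times> D" and g: "g holomorphic2_on D \<times> D"
    and h: "h holomorphic2_on D \<times> D"
    and lin: "\<forall>p\<in>D \<times> D. h p = a * f p + b * g p" and z: "z \<in> D"
  have "L h z = a * L f z + b * L g z"
    using L f g h lin z unfolding linear_map_hol_def by blast
  then show "T h z = a * T f z + b * T g z"
    using eq f g h z by (simp add: algebra_simps)
qed

theorem theorem1:
  fixes D :: "complex set" and k1 k2 l :: nat
    and C1 C2 :: "complex \<Rightarrow> real \<Rightarrow> complex"
  assumes "open D" and "k1 \<ge> 1" and "k2 \<ge> 1"
    and "\<And>z. z \<in> D \<Longrightarrow> contour_around D z (C1 z)"
    and "\<And>z. z \<in> D \<Longrightarrow> contour_around D z (C2 z)"
  shows "linear_map_hol D (RC_integral C1 C2 k1 k2 l) \<and>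
    linear_map_hol D (RC k1 k2 l) \<and>
    (\<forall>f. f holomorphic2_on D \<times> D \<longrightarrow> (\<forall>z\<in>D.
       RC_integral C1 C2 k1 k2 l f z =
         (-1) ^ (k1 + l - 1) * fact (k1 + k2 + l - 2) / (fact (k1 + l - 1) * fact (k2 + l - 1))
         * RC k1 k2 l f z))"
proof -
  obtain p q where [simp]: "k1 = Suc p" "k2 = Suc q"
    using assms(2,3) by (metis One_nat_def Suc_le_D)
  have eq: "RC_integral C1 C2 k1 k2 l f z =
         (-1) ^ (k1 + l - 1) * fact (k1 + k2 + l - 2) / (fact (k1 + l - 1) * fact (k2 + l - 1))
         * RC k1 k2 l f z" if "f holomorphic2_on D \<times> D" "z \<in> D" for f z
    using RC_integral_eq_RC_Suc[of D z C1 C2 f p q l, OF assms(1) that(2) assms(4,5)[OF that(2)] that(1)] by simp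
  show ?thesis
    using linear_map_hol_RC[OF assms(1)] linear_map_hol_scaled[OF linear_map_hol_RC[OF assms(1)] eq] eq
    by blast
qed

end
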